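(* Let $\mathbb{G}$ be a homogeneous Lie group of homogeneous dimension $Q$, equipped with a quasi-norm $|\cdot|$. Let $1\le q<\infty$ and let $\alpha,\beta\in\mathbb{R}$. Then there exists a finite constant $C$ such that the inequality $$\left(\int_{\mathbb{G}}\left(\int_{\mathbb{B}(0,|x|)}|f(y)|\,dy\right)^q|x|^{-\beta q}\,dx\right)^{\frac1q}\le C\int_{\mathbb{G}}|f(x)|\,|x|^{\alpha}\,dx$$ holds for all measurable functions $f:\mathbb{G}\to\mathbb{C}$ if and only if $\beta q>Q$, $\alpha<0$ and $\alpha+\beta=\frac{Q}{q}$. Moreover, in this case the best (smallest) constant $C$ is $$C=|\mathfrak{S}|^{\frac1q}\,\frac{1}{|\beta q-Q|^{\frac1q}},$$ where $|\mathfrak{S}|$ is the area of the unit sphere of $\mathbb{G}$ with respect to the quasi-norm $|\cdot|$.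
   Context: A homogeneous Lie group $\mathbb{G}$ is a Lie group, identified with $(\mathbb{R}^N,\circ)$, equipped with dilations $D_\lambda(x)=(\lambda^{v_1}x_1,\ldots,\lambda^{v_N}x_N)$, $\lambda>0$, with fixed $v_1,\ldots,v_N>0$, such that each $D_\lambda$ is an automorphism of the group; one writes $\lambda x=D_\lambda(x)$. Its homogeneous dimension is $Q=v_1+\cdots+v_N$. The Haar measure $dx$ is the Lebesgue measure on $\mathbb{R}^N$. A quasi-norm on $\mathbb{G}$ is a continuous function $|\cdot|:\mathbb{G}\to[0,\infty)$ with $|x^{-1}|=|x|$ for all $x$, $|\lambda x|=\lambda|x|$ for all $x$ and $\lambda>0$, and $|x|=0$ if and only if $x=0$. The ball is $\mathbb{B}(0,r)=\{y\in\mathbb{G}:|y|\le r\}$. With $\mathfrak{S}=\{x\in\mathbb{G}:|x|=1\}$, there is a unique Radon measure $\sigma$ on $\mathfrak{S}$ such that for all $f\in L^1(\mathbb{G})$, $\int_{\mathbb{G}}f(x)\,dx=\int_0^\infty\int_{\mathfrak{S}}f(ry)\,r^{Q-1}\,d\sigma(y)\,dr$; the area of the unit sphere is $|\mathfrak{S}|=\sigma(\mathfrak{S})$. Both sides of the inequality are allowed to be $+\infty$. *)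

theory Defs
  imports "HOL-Analysis.Analysis" "HOL-Algebra.Group"
begin

(* f is of class C^k on the whole space: all iterated directional derivatives up to order k
   exist and are continuous. *)
primrec Ck :: "nat \<Rightarrow> ('a::euclidean_space \<Rightarrow> 'b::real_normed_vector) \<Rightarrow> bool" where
  "Ck 0 f \<longleftrightarrow> continuous_on UNIV f"
| "Ck (Suc k) f \<longleftrightarrow>
     f differentiable_on UNIV \<and> (\<forall>h. Ck k (\<lambda>x. frechet_derivative f (at x) h))"

definition smooth :: "('a::euclidean_space \<Rightarrow> 'b::real_normed_vector) \<Rightarrow> bool" where
  "smooth f \<longleftrightarrow> (\<forall>k. Ck k f)"

definition dil :: "('n::finite \<Rightarrow> real) \<Rightarrow> real \<Rightarrow> real^'n \<Rightarrow> real^'n" where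
  "dil v t x = (\<chi> i. t powr v i * x $ i)"

definition hom_dim :: "('n::finite \<Rightarrow> real) \<Rightarrow> real" where
  "hom_dim v = (\<Sum>i\<in>UNIV. v i)"

(* The manifold underlying the group is real^'n with its standard smooth structure.
   The dilations fix only the origin, so the unit of G is 0.  By homogeneity the
   translations are polynomial maps with unipotent triangular Jacobian matrix, so that
   Lebesgue measure is automatically a left and right Haar measure of G. *)
locale homogeneous_lie_group = group G for G :: "(real^'n::finite) monoid" (structure) +
  fixes v :: "'n \<Rightarrow> real"
  assumes carrier_UNIV: "carrier G = UNIV"
    and smooth_mult: "smooth (\<lambda>p. fst p \<otimes> snd p)"
    and smooth_inv: "smooth (\<lambda>x. inv x)"
    and weight_pos: "v i > 0"
    and dil_automorphism: "t > 0 \<Longrightarrow> dil v t \<in> iso G G"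

locale homogeneous_quasi_norm = homogeneous_lie_group G v
  for G :: "(real^'n::finite) monoid" (structure) and v :: "'n \<Rightarrow> real" +
  fixes N :: "real^'n \<Rightarrow> real"
  assumes qn_continuous: "continuous_on UNIV N"
    and qn_nonneg: "N x \<ge> 0"
    and qn_inv: "N (inv x) = N x"
    and qn_dil: "t > 0 \<Longrightarrow> N (dil v t x) = t * N x"
    and qn_eq_0_iff: "N x = 0 \<longleftrightarrow> x = 0"

definition qball :: "('a \<Rightarrow> real) \<Rightarrow> real \<Rightarrow> 'a set" where
  "qball N r = {y. N y \<le> r}"

definition qsphere :: "('a \<Rightarrow> real) \<Rightarrow> 'a set" where
  "qsphere N = {x. N x = 1}"

definition radon_measure_on :: "'a::topological_space set \<Rightarrow> 'a measure \<Rightarrow> bool" where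
  "radon_measure_on S \<sigma> \<longleftrightarrow>
     sets \<sigma> = sets (restrict_space borel S) \<and>
     (\<forall>K. compact K \<and> K \<subseteq> S \<longrightarrow> emeasure \<sigma> K < \<infinity>) \<and>
     (\<forall>A\<in>sets \<sigma>. emeasure \<sigma> A = (SUP K\<in>{K. compact K \<and> K \<subseteq> A}. emeasure \<sigma> K))"

(* Polar decomposition of Lebesgue measure.  The test functions are Borel representatives of
   classes in L^1, since sigma is a measure on the Borel sets of the sphere. *)
definition polar_measure ::
  "('n::finite \<Rightarrow> real) \<Rightarrow> (real^'n \<Rightarrow> real) \<Rightarrow> (real^'n) measure \<Rightarrow> bool" where
  "polar_measure v N \<sigma> \<longleftrightarrow>
     radon_measure_on (qsphere N) \<sigma> \<and>
     (\<forall>f :: real^'n \<Rightarrow> complex. integrable lborel f \<longrightarrow>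
        (LINT x|lborel. f x) =
        (LINT r:{0<..}|lborel.
           (LINT y|\<sigma>. (r powr (hom_dim v - 1)) *\<^sub>R f (dil v r y))))"

(* For a quasi-norm on a homogeneous Lie group there is exactly one such measure. *)
definition sphere_measure ::
  "('n::finite \<Rightarrow> real) \<Rightarrow> (real^'n \<Rightarrow> real) \<Rightarrow> (real^'n) measure" where
  "sphere_measure v N = (THE \<sigma>. polar_measure v N \<sigma>)"

definition sphere_area :: "('n::finite \<Rightarrow> real) \<Rightarrow> (real^'n \<Rightarrow> real) \<Rightarrow> real" where
  "sphere_area v N = measure (sphere_measure v N) (qsphere N)"

(* Only meant for p > 0. *)
definition ennreal_powr :: "ennreal \<Rightarrow> real \<Rightarrow> ennreal" where
  "ennreal_powr a p = (if a = \<infinity> then \<infinity> else ennreal (enn2real a powr p))"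

(* The factors N x powr _ take the junk value 0 at x = 0, which is a null set. *)
definition hardy_inequality ::
  "(real^'n::finite \<Rightarrow> real) \<Rightarrow> real \<Rightarrow> real \<Rightarrow> real \<Rightarrow> real \<Rightarrow> (real^'n \<Rightarrow> complex) \<Rightarrow> bool" where
  "hardy_inequality N q \<alpha> \<beta> C f \<longleftrightarrow>
     ennreal_powr
       (\<integral>\<^sup>+x. ennreal_powr (\<integral>\<^sup>+y\<in>qball N (N x). ennreal (norm (f y)) \<partial>lebesgue) q
                * ennreal (N x powr (- \<beta> * q)) \<partial>lebesgue)
       (1 / q)
     \<le> ennreal C * (\<integral>\<^sup>+x. ennreal (norm (f x)) * ennreal (N x powr \<alpha>) \<partial>lebesgue)"

definition hardy_constant ::
  "(real^'n::finite \<Rightarrow> real) \<Rightarrow> real \<Rightarrow> real \<Rightarrow> real \<Rightarrow> real \<Rightarrow> bool" where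
  "hardy_constant N q \<alpha> \<beta> C \<longleftrightarrow>
     C \<ge> 0 \<and> (\<forall>f \<in> borel_measurable lebesgue. hardy_inequality N q \<alpha> \<beta> C f)"

end

(* In polar coordinates Lebesgue measure becomes the product of r^(Q-1) dr and a finite measure sigma
   on the quasi-sphere, sigma(A) being Q times the volume of the cone over A inside the unit quasi-ball.
   With K = |S| / (beta q - Q), the integral of |x|^(-beta q) over |x| >= s is therefore K s^(Q - beta q).

   Sufficiency: by Jensen's inequality for the measure |f(y)| |y|^alpha dy of mass M, the q-th power of
   the integral of |f| over the ball of radius |x| is at most M^(q-1) times the integral of
   |f(y)| |y|^(alpha - alpha q) over that ball; integrating against |x|^(-beta q) dx and exchanging the
   integrals gives K M^q.

   Necessity and sharpness: for f the indicator of a <= |y| <= b, the left side is bounded below by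
   the contribution of |x| >= b and the volume of the shell cancels.  Letting a tend to b leaves
   K^(1/q) b^((Q - beta q)/q) <= C b^alpha for all b > 0. *)

theory Submission
  imports Defs
begin

section \<open>Dilations and their effect on Lebesgue measure\<close>

lemma vec_lambda_eq_sum_axis: "(\<chi> i. f i) = (\<Sum>i\<in>UNIV. f i *\<^sub>R axis i (1::real))"
  by (simp add: vec_eq_iff axis_def if_distrib[of "\<lambda>c. _ * c"] cong: if_cong)

text \<open>The dilation parameter may vary with the point, as it does in \<open>proj\<close> and in
  the polar map from \<open>(r, y)\<close> to \<open>dil v r y\<close>.\<close>

lemma dil_measurable [measurable (raw)]:
  assumes [measurable]: "r \<in> borel_measurable M" "f \<in> borel_measurable M"
  shows "(\<lambda>p. dil v (r p) (f p)) \<in> borel_measurable M"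
proof -
  have *: "(\<lambda>p. dil v (r p) (f p)) = (\<lambda>p. \<Sum>i\<in>UNIV. (r p powr v i * (f p \<bullet> axis i 1)) *\<^sub>R axis i 1)"
    by (simp add: dil_def vec_lambda_eq_sum_axis inner_axis)
  show ?thesis
    unfolding * by measurable
qed

lemma dil_dil: "s > 0 \<Longrightarrow> t > 0 \<Longrightarrow> dil v s (dil v t x) = dil v (s * t) x"
  by (simp add: dil_def vec_eq_iff powr_mult)

lemma dil_1 [simp]: "dil v 1 x = x"
  by (simp add: dil_def vec_eq_iff)

lemma dil_0_right [simp]: "dil v t 0 = 0"
  by (simp add: dil_def vec_eq_iff)

text \<open>A dilation is a diagonal linear map whose determinant is the product of the
  \<open>t powr v i\<close>.\<close>

lemma emeasure_lborel_dil:
  fixes v :: "'n::finite \<Rightarrow> real"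
  assumes t: "t > 0" and A: "A \<in> sets borel"
  shows "emeasure lborel A = ennreal (t powr hom_dim v) * emeasure lborel (dil v t -` A)"
proof -
  \<comment> \<open>The affine change of variables takes coefficients indexed by basis vectors;
    \<open>THE\<close> recovers the coordinate from the vector.\<close>
  define c where "c = (\<lambda>j::real^'n. t powr v (THE i. j = axis i 1))"
  have c_axis: "c (axis i 1) = t powr v i" for i
    by (simp add: c_def axis_eq_axis)
  have Basis: "(Basis :: (real^'n) set) = (\<lambda>i. axis i 1) ` UNIV"
    by (auto simp: Basis_vec_def)
  have inj: "inj (\<lambda>i. axis i 1 :: real^'n)"
    by (auto simp: inj_on_def axis_eq_axis)
  have T: "(\<lambda>x. 0 + (\<Sum>j\<in>Basis. (c j * (x \<bullet> j)) *\<^sub>R j)) = dil v t"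
    unfolding Basis sum.reindex[OF inj]
    by (rule ext) (simp add: dil_def vec_lambda_eq_sum_axis inner_axis c_axis)
  have "(\<Prod>j\<in>Basis. \<bar>c j\<bar>) = t powr hom_dim v"
    unfolding Basis prod.reindex[OF inj] using t by (simp add: c_axis hom_dim_def powr_sum)
  moreover have "c j \<noteq> 0" for j using t by (simp add: c_def)
  ultimately have "(lborel :: (real^'n) measure) = density (distr lborel borel (dil v t)) (\<lambda>_. ennreal (t powr hom_dim v))"
    using lborel_affine_euclidean[of c 0] unfolding T by simp
  then have "emeasure lborel A = emeasure (density (distr lborel borel (dil v t)) (\<lambda>_. ennreal (t powr hom_dim v))) A"
    by simp
  also have "\<dots> = ennreal (t powr hom_dim v) * emeasure lborel (dil v t -` A)"
    using A by (simp add: emeasure_density nn_integral_cmult_indicator emeasure_distr)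
  finally show ?thesis .
qed

section \<open>One-dimensional integrals of powers\<close>

lemma nn_integral_powr_atMost:
  fixes p R :: real
  assumes "p > 0" "R \<ge> 0"
  shows "(\<integral>\<^sup>+r. ennreal (indicator {0<..} r * r powr (p - 1)) * indicator {..R} r \<partial>lborel) = ennreal (R powr p / p)"
proof -
  have "(\<integral>\<^sup>+r. ennreal (indicator {0<..} r * r powr (p - 1)) * indicator {..R} r \<partial>lborel)
      = (\<integral>\<^sup>+r. ennreal (indicator {0..R} r * r powr (p - 1)) \<partial>lborel)"
    by (rule nn_integral_cong) (auto split: split_indicator)
  also have "\<dots> = ennreal (R powr p / p)"
    using nn_integral_has_integral_lebesgue[OF _ has_integral_powr_from_0[of "p - 1" R]] assms by simp
  finally show ?thesis .
qed

lemma nn_integral_powr_atLeast: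
  fixes p s :: real
  assumes "p < 0" "s > 0"
  shows "(\<integral>\<^sup>+r. ennreal (r powr (p - 1)) * indicator {s..} r \<partial>lborel) = ennreal (s powr p / (- p))"
proof -
  have "(\<integral>\<^sup>+r. ennreal (r powr (p - 1)) * indicator {s..} r \<partial>lborel)
      = (\<integral>\<^sup>+r. ennreal (indicator {s..} r * r powr (p - 1)) \<partial>lborel)"
    by (rule nn_integral_cong) (auto split: split_indicator)
  also have "\<dots> = ennreal (s powr p / (- p))"
    using nn_integral_has_integral_lebesgue[OF _ has_integral_powr_to_inf[of "p - 1" s]] assms by simp
  finally show ?thesis .
qed

text \<open>For \<open>r \<ge> s \<ge> 1\<close> the integrand dominates \<open>1 / r\<close>, whose
  integral diverges logarithmically.\<close>

lemma nn_integral_powr_atLeast_infinite: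
  fixes p s :: real
  assumes "p \<ge> 0" "s \<ge> 1"
  shows "(\<integral>\<^sup>+r. ennreal (r powr (p - 1)) * indicator {s..} r \<partial>lborel) = \<infinity>"
proof (rule ccontr)
  let ?I = "\<integral>\<^sup>+r. ennreal (r powr (p - 1)) * indicator {s..} r \<partial>lborel"
  assume "?I \<noteq> \<infinity>"
  then obtain B where B: "?I = ennreal B" "B \<ge> 0"
    by (cases ?I) auto
  \<comment> \<open>Chosen so that \<open>1 / r\<close> has integral \<open>B + 1\<close> over
    \<open>{s..T}\<close>, more than the supposed value \<open>B\<close>.\<close>
  define T where "T = s * exp (B + 1)"
  have T: "s \<le> T" using B assms by (simp add: T_def)
  have "((\<lambda>r. 1 / r) has_integral (ln T - ln s)) {s..T}"
    using assms T by (intro fundamental_theorem_of_calculus)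
      (auto intro!: derivative_eq_intros simp: has_real_derivative_iff_has_vector_derivative[symmetric])
  then have "(\<integral>\<^sup>+r. ennreal (indicator {s..T} r * (1 / r)) \<partial>lborel) = ennreal (ln T - ln s)"
    by (rule nn_integral_has_integral_lebesgue[rotated]) (use assms in auto)
  moreover have "(\<integral>\<^sup>+r. ennreal (indicator {s..T} r * (1 / r)) \<partial>lborel) \<le> ?I"
  proof (rule nn_integral_mono)
    fix r
    have "1 / r \<le> r powr (p - 1)" if "r \<ge> s"
      using powr_mono[of "-1" "p - 1" r] that assms by (simp add: powr_minus_divide)
    then show "ennreal (indicator {s..T} r * (1 / r)) \<le> ennreal (r powr (p - 1)) * indicator {s..} r"
      by (auto split: split_indicator intro!: ennreal_leI)
  qed
  moreover have "ln T - ln s = B + 1"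
    using assms by (simp add: T_def ln_mult)
  ultimately show False using B by simp
qed

section \<open>Powers in \<open>ennreal\<close> and Jensen's inequality\<close>

lemma ennreal_powr_ennreal [simp]: "x \<ge> 0 \<Longrightarrow> ennreal_powr (ennreal x) p = ennreal (x powr p)"
  by (simp add: ennreal_powr_def)

lemma ennreal_powr_top [simp]: "ennreal_powr top_class.top p = top_class.top"
  by (simp_all add: ennreal_powr_def)

lemma ennreal_powr_mono:
  assumes "a \<le> b" "p > 0"
  shows "ennreal_powr a p \<le> ennreal_powr b p"
proof (cases b)
  case (real y)
  with assms obtain x where "a = ennreal x" "x \<ge> 0"
    by (cases a) (auto simp: top_unique)
  with real assms show ?thesis by (auto intro!: ennreal_leI powr_mono2)
qed simp

lemma ennreal_powr_cmult:
  assumes "c > 0"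
  shows "ennreal_powr (ennreal c * a) p = ennreal (c powr p) * ennreal_powr a p"
  using assms
  by (cases a) (simp_all add: powr_mult ennreal_mult_top flip: ennreal_mult)

text \<open>Young's inequality, in the form that the graph of the \<open>q\<close>-th power lies
  above its tangent at \<open>c\<close>. This form covers \<open>q = 1\<close> without a conjugate
  exponent.\<close>

lemma powr_tangent_le:
  fixes h c q :: real
  assumes "h \<ge> 0" "c > 0" "q \<ge> 1"
  shows "h * c powr (q - 1) \<le> h powr q / q + (1 - 1 / q) * c powr q"
proof (cases "h = 0")
  case False
  have "q * (1 - 1 / q) = q - 1" using assms by (simp add: field_simps)
  then show ?thesis
    using Youngs_inequality_0[of "1 / q" "1 - 1 / q" "h powr q" "c powr q"] assms False
    by (simp add: powr_powr)
qed (use assms in simp)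

text \<open>Jensen's inequality for the measure of density \<open>w\<close> and mass at most
  \<open>m\<close>, obtained by integrating the tangent inequality at a well-chosen point
  \<open>c\<close>.\<close>

lemma powr_nn_integral_le:
  fixes h :: "'a \<Rightarrow> real"
  assumes [measurable]: "w \<in> borel_measurable M" "h \<in> borel_measurable M"
    and h: "\<And>x. h x \<ge> 0" and q: "q \<ge> 1" and m: "m > 0" "(\<integral>\<^sup>+x. w x \<partial>M) \<le> ennreal m"
  shows "ennreal_powr (\<integral>\<^sup>+x. w x * ennreal (h x) \<partial>M) q
      \<le> ennreal (m powr (q - 1)) * (\<integral>\<^sup>+x. w x * ennreal (h x powr q) \<partial>M)"
proof (cases "(\<integral>\<^sup>+x. w x * ennreal (h x powr q) \<partial>M)")
  case top
  then show ?thesis using m by (simp add: ennreal_mult_top)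
next
  case (real b)
  show ?thesis
  proof (cases "b = 0")
    \<comment> \<open>The tangent point of the other case would be 0 here; instead
      \<open>w * h\<close> vanishes almost everywhere.\<close>
    case True
    then have "AE x in M. w x * ennreal (h x powr q) = 0"
      using real by (subst nn_integral_0_iff_AE[symmetric]) auto
    then have "AE x in M. w x * ennreal (h x) = 0"
      by eventually_elim (use h in \<open>auto simp: ennreal_eq_0_iff\<close>)
    then have "(\<integral>\<^sup>+x. w x * ennreal (h x) \<partial>M) = ennreal 0"
      by (subst nn_integral_0_iff_AE[THEN iffD2]) auto
    then show ?thesis by (simp only: ennreal_powr_ennreal order_refl) simp
  next
    case False
    with real have b: "b > 0" by simp
    \<comment> \<open>The \<open>q\<close>-th power mean of \<open>h\<close> for total mass
      \<open>m\<close>: the two terms of the integrated tangent inequality become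
      \<open>b / q\<close> and at most \<open>(1 - 1 / q) * b\<close>.\<close>
    define c where "c = (b / m) powr (1 / q)"
    have c: "c > 0" using b m by (simp add: c_def)
    have cq: "c powr q = b / m" using b m q by (simp add: c_def powr_powr)
    have "(\<integral>\<^sup>+x. w x * ennreal (h x) \<partial>M) * ennreal (c powr (q - 1))
        = (\<integral>\<^sup>+x. w x * ennreal (h x * c powr (q - 1)) \<partial>M)"
      by (subst nn_integral_multc[symmetric]) (auto simp: ennreal_mult h mult.assoc)
    also have "\<dots> \<le> (\<integral>\<^sup>+x. w x * ennreal (h x powr q) * ennreal (1 / q) + w x * ennreal ((1 - 1 / q) * (b / m)) \<partial>M)"
    proof (rule nn_integral_mono)
      fix x
      have "ennreal (h x * c powr (q - 1)) \<le> ennreal (h x powr q * (1 / q) + (1 - 1 / q) * (b / m))"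
        using powr_tangent_le[OF h c q, of x] by (intro ennreal_leI) (simp add: cq)
      also have "\<dots> = ennreal (h x powr q) * ennreal (1 / q) + ennreal ((1 - 1 / q) * (b / m))"
        using q b m by (subst ennreal_plus) (auto simp: ennreal_mult[symmetric] divide_le_eq)
      finally have "w x * ennreal (h x * c powr (q - 1))
          \<le> w x * (ennreal (h x powr q) * ennreal (1 / q) + ennreal ((1 - 1 / q) * (b / m)))"
        by (rule mult_left_mono) simp
      then show "w x * ennreal (h x * c powr (q - 1))
          \<le> w x * ennreal (h x powr q) * ennreal (1 / q) + w x * ennreal ((1 - 1 / q) * (b / m))"
        by (simp add: distrib_left mult.assoc)
    qed
    also have "\<dots> = ennreal b * ennreal (1 / q) + (\<integral>\<^sup>+x. w x \<partial>M) * ennreal ((1 - 1 / q) * (b / m))"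
      by (subst nn_integral_add) (auto simp: nn_integral_multc real)
    also have "\<dots> \<le> ennreal b * ennreal (1 / q) + ennreal m * ennreal ((1 - 1 / q) * (b / m))"
      by (intro add_left_mono mult_right_mono m) simp
    also have "\<dots> = ennreal (b * (1 / q) + m * ((1 - 1 / q) * (b / m)))"
      using q b m by (subst ennreal_plus) (auto simp: ennreal_mult[symmetric] divide_le_eq)
    also have "b * (1 / q) + m * ((1 - 1 / q) * (b / m)) = b"
      using m q by (simp add: field_simps)
    finally have le: "(\<integral>\<^sup>+x. w x * ennreal (h x) \<partial>M) * ennreal (c powr (q - 1)) \<le> ennreal b" .
    then obtain A where A: "(\<integral>\<^sup>+x. w x * ennreal (h x) \<partial>M) = ennreal A" "A \<ge> 0"
      using c by (cases "\<integral>\<^sup>+x. w x * ennreal (h x) \<partial>M") (auto simp: ennreal_top_mult top_unique)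
    have "A * c powr (q - 1) \<le> b"
      using le A b by (simp add: ennreal_mult[symmetric])
    \<comment> \<open>After raising to the power \<open>q\<close>, both sides carry the positive
      factor \<open>(c powr q) powr (q - 1)\<close>, which cancels.\<close>
    then have "(A * c powr (q - 1)) powr q \<le> b powr q"
      using A q by (intro powr_mono2) auto
    also have "(A * c powr (q - 1)) powr q = A powr q * (c powr q) powr (q - 1)"
      using A by (simp add: powr_mult powr_powr mult.commute)
    also have "b powr q = (m powr (q - 1) * b) * (c powr q) powr (q - 1)"
      using b m by (simp add: cq powr_divide powr_diff)
    finally have "A powr q \<le> m powr (q - 1) * b"
      using b m by (simp add: cq)
    then show ?thesis
      using real A by (simp add: ennreal_mult[symmetric])
  qed
qed

section \<open>Geometry of quasi-balls and of the quasi-sphere\<close>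

context homogeneous_quasi_norm
begin

abbreviation "Q \<equiv> hom_dim v"

lemma Q_pos: "Q > 0"
  unfolding hom_dim_def by (intro sum_pos weight_pos) auto

lemma N_0 [simp]: "N 0 = 0"
  by (simp add: qn_eq_0_iff)

lemma N_pos: "x \<noteq> 0 \<Longrightarrow> N x > 0"
  using qn_nonneg[of x] qn_eq_0_iff[of x] by linarith

lemma N_measurable [measurable]: "N \<in> borel_measurable borel"
  using qn_continuous by (rule borel_measurable_continuous_onI)

text \<open>The projection onto the quasi-sphere along dilation orbits. As \<open>1 / 0 = 0\<close>,
  the origin is sent to itself and not to the quasi-sphere; it is a null set.\<close>

definition proj :: "real^'n \<Rightarrow> real^'n" where
  "proj x = dil v (1 / N x) x"

lemma proj_measurable [measurable]: "proj \<in> borel_measurable borel"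
  unfolding proj_def[abs_def] by measurable

lemma N_proj: "x \<noteq> 0 \<Longrightarrow> N (proj x) = 1"
  using N_pos[of x] by (simp add: proj_def qn_dil)

lemma dil_proj: "x \<noteq> 0 \<Longrightarrow> dil v (N x) (proj x) = x"
  using N_pos[of x] by (simp add: proj_def dil_dil)

lemma proj_dil: "t > 0 \<Longrightarrow> proj (dil v t x) = proj x"
  using N_pos[of x] by (cases "x = 0") (simp_all add: proj_def qn_dil dil_dil)

text \<open>The minimum \<open>m\<close> of \<open>N\<close> on the Euclidean unit sphere is positive; a point outside the Euclidean
  unit ball is dilated onto that sphere by some \<open>t \<le> 1\<close>, whence \<open>t N x \<ge> m\<close> and \<open>1 / t \<le> N x / m\<close>.\<close>
lemma bounded_qball: "bounded (qball N r)"
proof -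
  have cpt: "compact (sphere (0::real^'n) 1)" by simp
  have ne: "sphere (0::real^'n) 1 \<noteq> {}" by simp
  obtain e where e: "norm e = 1" "\<And>x. norm x = 1 \<Longrightarrow> N e \<le> N x"
    using continuous_attains_inf[OF cpt ne continuous_on_subset[OF qn_continuous]] by auto
  define m where "m = N e"
  have "e \<noteq> 0" using e(1) by auto
  then have m: "m > 0" using N_pos by (simp add: m_def)
  define R where "R = max 1 (r / m)"
  \<comment> \<open>The sum bounds the l1 norm of a Euclidean unit vector dilated by at most
    \<open>R\<close>; the 1 covers the Euclidean unit ball.\<close>
  define B where "B = max 1 (\<Sum>i\<in>UNIV. R powr v i)"
  have R: "R \<ge> 1" by (simp add: R_def)
  have "norm x \<le> B" if x: "x \<in> qball N r" for x
  proof (cases "norm x \<le> 1")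
    case True then show ?thesis by (simp add: B_def)
  next
    case False
    have cont: "continuous_on {0..1} (\<lambda>t. norm (dil v t x))"
    proof -
      \<comment> \<open>Continuity at \<open>t = 0\<close> rests on the positivity of the
        weights.\<close>
      have "continuous_on {0..1} (\<lambda>t. t powr v i)" for i
        using weight_pos[of i] by (intro continuous_on_powr') (auto intro!: continuous_intros)
      then show ?thesis
        unfolding dil_def
        by (intro continuous_on_norm continuous_on_vec_lambda continuous_on_mult continuous_on_const)
    qed
    have "dil v 0 x = 0" by (simp add: dil_def vec_eq_iff)
    then have "\<exists>t\<ge>0. t \<le> 1 \<and> norm (dil v t x) = 1"
      using False by (intro IVT'[OF _ _ _ cont]) auto
    then obtain t where t: "0 \<le> t" "t \<le> 1" "norm (dil v t x) = 1" by auto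
    have t0: "t > 0" using t \<open>dil v 0 x = 0\<close> by (cases "t = 0") auto
    have "m \<le> t * N x"
      using e(2)[OF t(3)] t0 by (simp add: m_def qn_dil)
    also have "\<dots> \<le> t * r" using x t0 by (simp add: qball_def)
    finally have "1 / t \<le> r / m" using m t0 by (simp add: field_simps)
    then have tR: "1 / t \<le> R" by (simp add: R_def)
    have "x = dil v (1 / t) (dil v t x)" using t0 by (simp add: dil_dil)
    then have "norm x \<le> (\<Sum>i\<in>UNIV. \<bar>(dil v (1 / t) (dil v t x)) $ i\<bar>)"
      using norm_le_l1_cart by metis
    also have "\<dots> \<le> (\<Sum>i\<in>UNIV. R powr v i)"
    proof (rule sum_mono)
      fix i
      have "\<bar>dil v t x $ i\<bar> \<le> 1" using component_le_norm_cart[of "dil v t x" i] t(3) by simp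
      moreover have "(1 / t) powr v i \<le> R powr v i"
        using tR t0 weight_pos[of i] by (intro powr_mono2) auto
      ultimately have "(1 / t) powr v i * \<bar>dil v t x $ i\<bar> \<le> R powr v i * 1"
        by (intro mult_mono) auto
      then show "\<bar>dil v (1 / t) (dil v t x) $ i\<bar> \<le> R powr v i"
        by (simp add: dil_def[of v "1 / t"] abs_mult)
    qed
    also have "\<dots> \<le> B" by (simp add: B_def)
    finally show ?thesis .
  qed
  then show ?thesis by (auto simp: bounded_iff)
qed

text \<open>A closed level set of \<open>N\<close> inside a bounded quasi-ball. Compactness makes
  every Radon measure on the quasi-sphere finite.\<close>

lemma compact_qsphere: "compact (qsphere N)"
proof -
  have "qsphere N = N -` {1}" by (auto simp: qsphere_def)
  then have "closed (qsphere N)"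
    using continuous_closed_vimage[OF closed_singleton, of N 1] qn_continuous
    by (simp add: continuous_on_eq_continuous_at)
  moreover have "bounded (qsphere N)"
    by (rule bounded_subset[OF bounded_qball[of 1]]) (auto simp: qsphere_def qball_def)
  ultimately show ?thesis by (simp add: compact_eq_bounded_closed)
qed

lemma qsphere_borel [measurable]: "qsphere N \<in> sets borel"
  using compact_qsphere by (simp add: borel_compact)

lemma qball_borel [measurable]: "qball N r \<in> sets borel"
  unfolding qball_def by measurable

lemma emeasure_qball_finite: "emeasure lborel (qball N r) < \<infinity>"
  using emeasure_bounded_finite[OF bounded_qball] by simp

lemma emeasure_qball_pos: 
  assumes "r > 0" shows "emeasure lborel (qball N r) > 0"
proof -
  have op: "open {x. N x < r}"
    using open_Collect_less[OF qn_continuous, of "\<lambda>_. r"] by simp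
  have "0 \<in> {x. N x < r}" using assms by simp
  then have "\<not> negligible {x. N x < r}"
    by (intro open_not_negligible[OF op]) (rule ex_in_conv[THEN iffD1, OF exI])
  then have "0 < emeasure lborel {x. N x < r}"
    by (simp add: negligible_iff_emeasure0 zero_less_iff_neq_zero)
  also have "\<dots> \<le> emeasure lborel (qball N r)"
    by (rule emeasure_mono) (auto simp: qball_def)
  finally show ?thesis .
qed

section \<open>Polar coordinates as an identity of measures\<close>

text \<open>The surface measure, as a measure on the whole space concentrated on the quasi-sphere:
  the cone over \<open>A\<close> inside the unit quasi-ball has Lebesgue measure \<open>1 / Q\<close> times the area of \<open>A\<close>.\<close>
definition cone_measure :: "(real^'n) measure" where
  "cone_measure = distr (density lborel (\<lambda>x. ennreal Q * indicator (qball N 1) x)) borel proj"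

lemma sets_cone_measure [simp, measurable_cong]: "sets cone_measure = sets borel"
  by (simp add: cone_measure_def)

lemma space_cone_measure [simp]: "space cone_measure = UNIV"
  by (simp add: cone_measure_def)

lemma emeasure_cone_measure:
  assumes [measurable]: "A \<in> sets borel"
  shows "emeasure cone_measure A = ennreal Q * emeasure lborel (qball N 1 \<inter> proj -` A)"
proof -
  have "proj -` A \<in> sets borel" by (rule measurable_sets_borel[OF proj_measurable]) fact
  then show ?thesis
    by (simp add: cone_measure_def emeasure_distr emeasure_density indicator_inter_arith[symmetric]
        nn_integral_cmult_indicator mult.assoc)
qed

lemma finite_cone_measure: "finite_measure cone_measure"
proof
  have "emeasure cone_measure UNIV < \<infinity>"
    using emeasure_qball_finite[of 1] by (simp add: emeasure_cone_measure ennreal_mult_less_top)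
  then show "emeasure cone_measure (space cone_measure) \<noteq> \<infinity>" by simp
qed

lemma AE_lborel_nonzero: "AE x in lborel. x \<noteq> (0::real^'n)"
  by (rule AE_lborel_singleton)

text \<open>Only the origin fails to project into the quasi-sphere, and it is a null set.\<close>

lemma AE_cone_measure: "AE y in cone_measure. y \<in> qsphere N"
  unfolding cone_measure_def
  by (subst AE_distr_iff)
    (use AE_lborel_nonzero in \<open>auto simp: AE_density qsphere_def N_proj\<close>)

text \<open>Dilation by \<open>R\<close> carries the cone of radius 1 over \<open>A\<close> to that
  of radius \<open>R\<close> and multiplies volume by \<open>R powr Q\<close>; the factor
  \<open>1 / Q\<close> undoes the normalization of \<open>cone_measure\<close>.\<close>

lemma emeasure_cone:
  assumes A [measurable]: "A \<in> sets borel" and R: "R > 0"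
  shows "emeasure lborel (qball N R \<inter> proj -` A) = ennreal (R powr Q / Q) * emeasure cone_measure A"
proof -
  have [measurable]: "proj -` A \<in> sets borel" by (rule measurable_sets_borel[OF proj_measurable A])
  have "dil v R -` (qball N R \<inter> proj -` A) = qball N 1 \<inter> proj -` A"
    using R by (auto simp: qball_def qn_dil proj_dil)
  then have "emeasure lborel (qball N R \<inter> proj -` A) = ennreal (R powr Q) * emeasure lborel (qball N 1 \<inter> proj -` A)"
    using emeasure_lborel_dil[OF R, of "qball N R \<inter> proj -` A" v] by simp
  also have "ennreal (R powr Q) = ennreal (R powr Q / Q) * ennreal Q"
    using Q_pos by (simp add: ennreal_mult[symmetric])
  finally show ?thesis by (simp add: emeasure_cone_measure mult.assoc)
qed

definition radial_measure :: "real measure" where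
  "radial_measure = density lborel (\<lambda>r. ennreal (indicator {0<..} r * r powr (Q - 1)))"

lemma sets_radial_measure [simp, measurable_cong]: "sets radial_measure = sets borel"
  by (simp add: radial_measure_def)

lemma emeasure_radial_atMost:
  "emeasure radial_measure {..R} = (if R \<le> 0 then 0 else ennreal (R powr Q / Q))"
proof (cases "R \<le> 0")
  case True
  have "emeasure radial_measure {..R} =
    (\<integral>\<^sup>+r. ennreal (indicator {0<..} r * r powr (Q - 1)) * indicator {..R} r \<partial>lborel)"
    by (simp add: radial_measure_def emeasure_density)
  also have "\<dots> = (\<integral>\<^sup>+(r::real). 0 \<partial>lborel)"
    by (rule nn_integral_cong) (use True in \<open>auto split: split_indicator\<close>)
  finally show ?thesis using True by simp
next
  case False
  then show ?thesis
    using nn_integral_powr_atMost[OF Q_pos, of R] by (simp add: radial_measure_def emeasure_density)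
qed

text \<open>The half-lines \<open>{..R}\<close> generate the Borel sets and are stable under
  intersection; on them both sides are given by \<open>emeasure_cone\<close> and
  \<open>emeasure_radial_atMost\<close>.\<close>

lemma distr_N_cone:
  assumes A [measurable]: "A \<in> sets borel"
  shows "distr (density lborel (indicator (proj -` A))) borel N
       = scale_measure (emeasure cone_measure A) radial_measure"
proof (rule measure_eqI_generator_eq[where E = "range (\<lambda>a::real. {..a})" and A = "\<lambda>i. {..real i}" and \<Omega> = UNIV])
  have pA [measurable]: "proj -` A \<in> sets borel" by (rule measurable_sets_borel[OF proj_measurable A])
  interpret finite_measure cone_measure by (rule finite_cone_measure)
  show "Int_stable (range (\<lambda>a::real. {..a}))"
    by (auto simp: Int_stable_def)
  have *: "emeasure (distr (density lborel (indicator (proj -` A))) borel N) {..R}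
       = emeasure (scale_measure (emeasure cone_measure A) radial_measure) {..R}" for R
  proof -
    have "N -` {..R} = qball N R" by (auto simp: qball_def)
    then have L: "emeasure (distr (density lborel (indicator (proj -` A))) borel N) {..R}
      = emeasure lborel (qball N R \<inter> proj -` A)"
      by (simp add: emeasure_distr emeasure_density indicator_inter_arith[symmetric] Int_commute)
    show ?thesis
    proof (cases "R \<le> 0")
      case True
      have "qball N R \<subseteq> {0}"
        using True N_pos by (force simp: qball_def)
      then have "emeasure lborel (qball N R \<inter> proj -` A) \<le> emeasure lborel {0::real^'n}"
        by (intro emeasure_mono) auto
      then show ?thesis using True by (simp add: L emeasure_radial_atMost)
    next
      case False
      then show ?thesis by (simp add: L emeasure_cone[OF A] emeasure_radial_atMost mult.commute)
    qed
  qed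
  show "emeasure (distr (density lborel (indicator (proj -` A))) borel N) X
       = emeasure (scale_measure (emeasure cone_measure A) radial_measure) X"
    if "X \<in> range (\<lambda>a::real. {..a})" for X
    using that * by auto
  have "sets (borel :: real measure) = sigma_sets UNIV (range (\<lambda>a::real. {..a}))"
    by (subst borel_eq_atMost) simp
  then show "sets (distr (density lborel (indicator (proj -` A))) borel N) = sigma_sets UNIV (range (\<lambda>a::real. {..a}))"
    "sets (scale_measure (emeasure cone_measure A) radial_measure) = sigma_sets UNIV (range (\<lambda>a::real. {..a}))"
    by auto
  show "(\<Union>i. {..real i}) = UNIV"
    using real_arch_simple by auto
  show "emeasure (distr (density lborel (indicator (proj -` A))) borel N) {..real i} \<noteq> \<infinity>" for i
    by (simp add: * emeasure_radial_atMost ennreal_mult_eq_top_iff)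
qed auto

lemma sigma_finite_radial_measure: "sigma_finite_measure radial_measure"
  unfolding radial_measure_def
  by (subst sigma_finite_measure.sigma_finite_iff_density_finite[OF sigma_finite_lborel]) auto

text \<open>A product of sigma-finite measures is determined by its values on rectangles, and
  \<open>distr_N_cone\<close> supplies these.\<close>

lemma distr_polar:
  "distr lborel (borel \<Otimes>\<^sub>M borel) (\<lambda>x. (N x, proj x)) = radial_measure \<Otimes>\<^sub>M cone_measure"
proof (rule pair_measure_eqI[symmetric])
  interpret finite_measure cone_measure by (rule finite_cone_measure)
  show "sigma_finite_measure cone_measure" ..
  show "sigma_finite_measure radial_measure" by (rule sigma_finite_radial_measure)
  show "sets (radial_measure \<Otimes>\<^sub>M cone_measure) = sets (distr lborel (borel \<Otimes>\<^sub>M borel) (\<lambda>x. (N x, proj x)))"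
    by (simp cong: sets_pair_measure_cong)
  fix A B assume "A \<in> sets radial_measure" "B \<in> sets cone_measure"
  then have A [measurable]: "A \<in> sets borel" and B [measurable]: "B \<in> sets borel" by auto
  have [measurable]: "proj -` B \<in> sets borel" by (rule measurable_sets_borel[OF proj_measurable B])
  have [measurable]: "N -` A \<in> sets borel" by (rule measurable_sets_borel[OF N_measurable A])
  have "emeasure radial_measure A * emeasure cone_measure B
      = emeasure (distr (density lborel (indicator (proj -` B))) borel N) A"
    by (simp add: distr_N_cone mult.commute)
  also have "\<dots> = emeasure lborel (N -` A \<inter> proj -` B)"
    by (simp add: emeasure_distr emeasure_density indicator_inter_arith[symmetric] Int_commute)
  also have "N -` A \<inter> proj -` B = (\<lambda>x. (N x, proj x)) -` (A \<times> B)" by auto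
  also have "emeasure lborel \<dots> = emeasure (distr lborel (borel \<Otimes>\<^sub>M borel) (\<lambda>x. (N x, proj x))) (A \<times> B)"
    by (subst emeasure_distr) auto
  finally show "emeasure radial_measure A * emeasure cone_measure B
      = emeasure (distr lborel (borel \<Otimes>\<^sub>M borel) (\<lambda>x. (N x, proj x))) (A \<times> B)" .
qed

section \<open>The surface measure is the unique measure of the polar decomposition\<close>

definition surface_measure :: "(real^'n) measure" where
  "surface_measure = restrict_space cone_measure (qsphere N)"

lemma emeasure_surface_measure:
  assumes "A \<in> sets borel" "A \<subseteq> qsphere N"
  shows "emeasure surface_measure A = emeasure cone_measure A"
  unfolding surface_measure_def using assms
  by (intro emeasure_restrict_space) auto

lemma sets_surface_measure: "sets surface_measure = sets (restrict_space borel (qsphere N))"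
  unfolding surface_measure_def by (rule sets_restrict_space_cong) simp

lemma sets_surface_measure_iff:
  "A \<in> sets (restrict_space borel (qsphere N)) \<longleftrightarrow> A \<in> sets borel \<and> A \<subseteq> qsphere N"
  by (subst sets_restrict_space_iff) auto

text \<open>Finite Borel measures on a Euclidean space are inner regular, and on Borel subsets of
  the quasi-sphere the two measures agree.\<close>

lemma radon_surface_measure: "radon_measure_on (qsphere N) surface_measure"
proof -
  interpret finite_measure cone_measure by (rule finite_cone_measure)
  have "emeasure surface_measure K < \<infinity>" if "compact K" "K \<subseteq> qsphere N" for K
    using that by (simp add: emeasure_surface_measure borel_compact less_top[symmetric])
  moreover have "emeasure surface_measure A = (SUP K\<in>{K. compact K \<and> K \<subseteq> A}. emeasure surface_measure K)"
    if "A \<in> sets surface_measure" for A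
  proof -
    from that have A: "A \<in> sets borel" "A \<subseteq> qsphere N"
      by (auto simp: sets_surface_measure sets_surface_measure_iff)
    have "emeasure surface_measure A = (SUP K\<in>{K. K \<subseteq> A \<and> compact K}. emeasure cone_measure K)"
      unfolding emeasure_surface_measure[OF A] using A by (intro inner_regular) auto
    also have "\<dots> = (SUP K\<in>{K. compact K \<and> K \<subseteq> A}. emeasure surface_measure K)"
      using A by (intro SUP_cong) (auto simp: emeasure_surface_measure borel_compact)
    finally show ?thesis .
  qed
  ultimately show ?thesis
    by (auto simp: radon_measure_on_def sets_surface_measure)
qed

text \<open>Off the origin \<open>F (N x, proj x) = f x\<close>, so this is Fubini's theorem for the
  product measure in \<open>distr_polar\<close>.\<close>

lemma polar_surface_measure: "polar_measure v N surface_measure"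
  unfolding polar_measure_def
proof (intro conjI allI impI)
  show "radon_measure_on (qsphere N) surface_measure" by (rule radon_surface_measure)
  fix f :: "real^'n \<Rightarrow> complex" assume f: "integrable lborel f"
  then have [measurable]: "f \<in> borel_measurable borel" by auto
  interpret C: finite_measure cone_measure by (rule finite_cone_measure)
  interpret R: sigma_finite_measure radial_measure by (rule sigma_finite_radial_measure)
  interpret P: pair_sigma_finite radial_measure cone_measure ..
  define F where "F = (\<lambda>p. f (dil v (fst p) (snd p)))"
  have [measurable]: "F \<in> borel_measurable (borel \<Otimes>\<^sub>M borel)"
    unfolding F_def by measurable
  have AE: "AE x in lborel. F (N x, proj x) = f x"
    using AE_lborel_nonzero by eventually_elim (simp add: F_def dil_proj)
  have "integrable lborel (\<lambda>x. F (N x, proj x))"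
    using f AE by (subst integrable_cong_AE[where g = f]) auto
  then have "integrable (distr lborel (borel \<Otimes>\<^sub>M borel) (\<lambda>x. (N x, proj x))) F"
    by (subst integrable_distr_eq) auto
  then have int: "integrable (radial_measure \<Otimes>\<^sub>M cone_measure) F"
    by (simp add: distr_polar)
  have "(LINT x|lborel. f x) = (LINT x|lborel. F (N x, proj x))"
    using AE by (intro integral_cong_AE) auto
  also have "\<dots> = integral\<^sup>L (distr lborel (borel \<Otimes>\<^sub>M borel) (\<lambda>x. (N x, proj x))) F"
    by (rule integral_distr[symmetric]) auto
  also have "\<dots> = (LINT r|radial_measure. (LINT y|cone_measure. F (r, y)))"
    unfolding distr_polar by (rule P.integral_fst'[symmetric, OF int])
  also have "\<dots> = (LINT r|lborel. (indicator {0<..} r * r powr (Q - 1)) *\<^sub>R (LINT y|cone_measure. F (r, y)))"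
    unfolding radial_measure_def by (rule integral_density) auto
  also have "\<dots> = (LINT r:{0<..}|lborel. (LINT y|surface_measure. (r powr (Q - 1)) *\<^sub>R f (dil v r y)))"
    unfolding set_lebesgue_integral_def
  proof (rule Bochner_Integration.integral_cong[OF refl])
    fix r
    have "(LINT y|surface_measure. (r powr (Q - 1)) *\<^sub>R f (dil v r y))
        = (LINT y|cone_measure. indicator (qsphere N) y *\<^sub>R (r powr (Q - 1)) *\<^sub>R f (dil v r y))"
      unfolding surface_measure_def by (rule integral_restrict_space) simp
    also have "\<dots> = (LINT y|cone_measure. (r powr (Q - 1)) *\<^sub>R f (dil v r y))"
    proof (rule integral_cong_AE)
      show "AE y in cone_measure. indicator (qsphere N) y *\<^sub>R (r powr (Q - 1)) *\<^sub>R f (dil v r y)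
          = (r powr (Q - 1)) *\<^sub>R f (dil v r y)"
        using AE_cone_measure by eventually_elim simp
    qed measurable
    also have "\<dots> = (r powr (Q - 1)) *\<^sub>R (LINT y|cone_measure. F (r, y))"
      by (simp add: F_def)
    finally show "(indicator {0<..} r * r powr (Q - 1)) *\<^sub>R (LINT y|cone_measure. F (r, y))
      = indicator {0<..} r *\<^sub>R (LINT y|surface_measure. (r powr (Q - 1)) *\<^sub>R f (dil v r y))"
      by (simp only: scaleR_scaleR)
  qed
  finally show "(LINT x|lborel. f x) = (LINT r:{0<..}|lborel. (LINT y|surface_measure. (r powr (Q - 1)) *\<^sub>R f (dil v r y)))" .
qed

text \<open>Testing the polar formula on the indicator of the cone over \<open>A\<close> inside the unit quasi-ball
  determines the measure of \<open>A\<close>.\<close>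
lemma polar_measure_unique:
  assumes "polar_measure v N \<sigma>"
  shows "\<sigma> = surface_measure"
proof (rule measure_eqI)
  from assms have radon: "radon_measure_on (qsphere N) \<sigma>"
    and polar: "\<And>f :: real^'n \<Rightarrow> complex. integrable lborel f \<Longrightarrow> (LINT x|lborel. f x) =
        (LINT r:{0<..}|lborel. (LINT y|\<sigma>. (r powr (Q - 1)) *\<^sub>R f (dil v r y)))"
    by (auto simp: polar_measure_def)
  have sets: "sets \<sigma> = sets (restrict_space borel (qsphere N))"
    using radon by (simp add: radon_measure_on_def)
  then show "sets \<sigma> = sets surface_measure" by (simp add: sets_surface_measure)
  have space: "space \<sigma> = qsphere N"
    using sets_eq_imp_space_eq[OF sets] by (simp add: space_restrict_space)
  have "finite_measure \<sigma>"
    using radon compact_qsphere by (intro finite_measureI) (auto simp: radon_measure_on_def space)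
  then interpret S: finite_measure \<sigma> .
  interpret C: finite_measure cone_measure by (rule finite_cone_measure)
  fix A assume "A \<in> sets \<sigma>"
  then have A [measurable]: "A \<in> sets borel" and AS: "A \<subseteq> qsphere N" and A\<sigma> [measurable]: "A \<in> sets \<sigma>"
    by (auto simp: sets sets_surface_measure_iff)
  have [measurable]: "proj -` A \<in> sets borel" by (rule measurable_sets_borel[OF proj_measurable A])
  define E where "E = qball N 1 \<inter> proj -` A"
  have E [measurable]: "E \<in> sets borel" by (simp add: E_def)
  have Em: "emeasure lborel E = ennreal (measure cone_measure A / Q)"
    using emeasure_cone[OF A, of 1] Q_pos
    by (simp add: E_def C.emeasure_eq_measure ennreal_mult[symmetric])
  define f :: "real^'n \<Rightarrow> complex" where "f = (\<lambda>x. of_real (indicator E x))"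
  have int: "integrable lborel f" and val: "(LINT x|lborel. f x) = complex_of_real (measure cone_measure A / Q)"
    using Em Q_pos by (auto simp: f_def measure_def)
  \<comment> \<open>In polar coordinates the indicator of the truncated cone splits into a radial
    and an angular factor; the iterated integral thus becomes \<open>1 / Q\<close> times
    \<open>measure \<sigma> A\<close>.\<close>
  have fd: "f (dil v r y) = of_real (indicator {..1} r * indicator A y)" if "r > 0" "y \<in> qsphere N" for r y
  proof -
    have "proj y = y" using that by (simp add: proj_def qsphere_def)
    then have "dil v r y \<in> E \<longleftrightarrow> r \<le> 1 \<and> y \<in> A"
      using that by (simp add: E_def qball_def qn_dil proj_dil qsphere_def)
    then show ?thesis by (simp add: f_def indicator_def)
  qed
  have "complex_of_real (measure cone_measure A / Q) =
     (LINT r:{0<..}|lborel. (LINT y|\<sigma>. (r powr (Q - 1)) *\<^sub>R f (dil v r y)))"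
    using polar[OF int] val by simp
  also have "\<dots> = (LINT r|lborel. of_real (indicator {0..1} r * r powr (Q - 1)) * of_real (measure \<sigma> A))"
    unfolding set_lebesgue_integral_def
  proof (rule Bochner_Integration.integral_cong[OF refl])
    fix r :: real
    show "indicator {0<..} r *\<^sub>R (LINT y|\<sigma>. (r powr (Q - 1)) *\<^sub>R f (dil v r y))
      = of_real (indicator {0..1} r * r powr (Q - 1)) * complex_of_real (measure \<sigma> A)"
    proof (cases "r > 0")
      case True
      have "(LINT y|\<sigma>. (r powr (Q - 1)) *\<^sub>R f (dil v r y))
         = (LINT y|\<sigma>. complex_of_real ((r powr (Q - 1) * indicator {..1} r) * indicator A y))"
        by (intro Bochner_Integration.integral_cong refl)
          (auto simp: fd[OF True] space scaleR_conv_of_real)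
      also have "\<dots> = of_real ((r powr (Q - 1) * indicator {..1} r) * measure \<sigma> A)"
        by (subst integral_complex_of_real) (simp add: space AS Int_absorb2)
      finally show ?thesis using True by (auto simp: indicator_def)
    next
      case False
      \<comment> \<open>At \<open>r = 0\<close> the right-hand side vanishes because
        \<open>0 powr (Q - 1)\<close> is 0.\<close>
      then show ?thesis by (cases "r = 0") (auto simp: indicator_def)
    qed
  qed
  also have "\<dots> = (LINT r|lborel. complex_of_real (indicator {0..1} r * r powr (Q - 1))) * of_real (measure \<sigma> A)"
    by simp
  also have "(LINT r|lborel. complex_of_real (indicator {0..1} r * r powr (Q - 1))) = of_real (1 / Q)"
  proof -
    have "(\<integral>\<^sup>+r. ennreal (indicator {0..1} r * r powr (Q - 1)) \<partial>lborel) = ennreal (1 / Q)"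
      using nn_integral_has_integral_lebesgue[OF _ has_integral_powr_from_0[of "Q - 1" 1]] Q_pos by simp
    then have "(LINT r|lborel. indicator {0..1} r * r powr (Q - 1)) = 1 / Q"
      using Q_pos by (subst integral_eq_nn_integral) auto
    then show ?thesis by (simp only: integral_complex_of_real)
  qed
  finally have "complex_of_real (measure cone_measure A / Q) = complex_of_real (measure \<sigma> A / Q)"
    by simp
  then have "measure cone_measure A / Q = measure \<sigma> A / Q" by (simp only: of_real_eq_iff)
  then show "emeasure \<sigma> A = emeasure surface_measure A"
    using Q_pos by (simp add: emeasure_surface_measure[OF A AS] C.emeasure_eq_measure S.emeasure_eq_measure)
qed

text \<open>Existence and uniqueness together make the definite description meaningful.\<close>

lemma sphere_measure_eq: "sphere_measure v N = surface_measure"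
  unfolding sphere_measure_def
  using polar_surface_measure polar_measure_unique by (rule the_equality)

lemma emeasure_cone_measure_UNIV: "emeasure cone_measure UNIV = ennreal (sphere_area v N)"
proof -
  interpret C: finite_measure cone_measure by (rule finite_cone_measure)
  have "emeasure cone_measure UNIV = emeasure cone_measure (qsphere N)"
    using AE_cone_measure by (intro emeasure_eq_AE) auto
  also have "\<dots> = ennreal (sphere_area v N)"
    unfolding sphere_area_def sphere_measure_eq measure_def
    by (subst emeasure_surface_measure) (auto simp: C.emeasure_eq_measure)
  finally show ?thesis .
qed

text \<open>The total area is \<open>Q\<close> times the volume of the unit quasi-ball.\<close>

lemma sphere_area_pos: "sphere_area v N > 0"
proof -
  have "emeasure cone_measure UNIV > 0"
    using emeasure_qball_pos[of 1] Q_pos by (simp add: emeasure_cone_measure ennreal_zero_less_mult_iff)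
  then show ?thesis by (simp add: emeasure_cone_measure_UNIV)
qed

section \<open>Integrals of radial functions\<close>

lemma nn_integral_radial:
  assumes [measurable]: "h \<in> borel_measurable borel"
  shows "(\<integral>\<^sup>+x. h (N x) \<partial>lborel) =
    ennreal (sphere_area v N) * (\<integral>\<^sup>+r. ennreal (indicator {0<..} r * r powr (Q - 1)) * h r \<partial>lborel)"
proof -
  have "distr lborel borel N = scale_measure (ennreal (sphere_area v N)) radial_measure"
    using distr_N_cone[of UNIV] by (simp add: density_1 emeasure_cone_measure_UNIV)
  moreover have "(\<integral>\<^sup>+x. h (N x) \<partial>lborel) = integral\<^sup>N (distr lborel borel N) h"
    by (simp add: nn_integral_distr)
  ultimately have "(\<integral>\<^sup>+x. h (N x) \<partial>lborel) = ennreal (sphere_area v N) * integral\<^sup>N radial_measure h"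
    by (simp add: nn_integral_scale_measure)
  then show ?thesis
    by (simp add: radial_measure_def nn_integral_density)
qed

lemma nn_integral_radial_atLeast:
  assumes "s > 0"
  shows "(\<integral>\<^sup>+x. ennreal (N x powr - (\<beta> * q)) * indicator {s..} (N x) \<partial>lborel)
    = ennreal (sphere_area v N) * (\<integral>\<^sup>+r. ennreal (r powr ((Q - \<beta> * q) - 1)) * indicator {s..} r \<partial>lborel)"
proof -
  have "(\<integral>\<^sup>+x. ennreal (N x powr - (\<beta> * q)) * indicator {s..} (N x) \<partial>lborel)
    = ennreal (sphere_area v N) * (\<integral>\<^sup>+r. ennreal (indicator {0<..} r * r powr (Q - 1)) *
        (ennreal (r powr - (\<beta> * q)) * indicator {s..} r) \<partial>lborel)"
    by (rule nn_integral_radial) measurable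
  also have "(\<integral>\<^sup>+r. ennreal (indicator {0<..} r * r powr (Q - 1)) *
        (ennreal (r powr - (\<beta> * q)) * indicator {s..} r) \<partial>lborel)
     = (\<integral>\<^sup>+r. ennreal (r powr ((Q - \<beta> * q) - 1)) * indicator {s..} r \<partial>lborel)"
    using assms
    by (intro nn_integral_cong)
      (auto split: split_indicator simp: ennreal_mult[symmetric] powr_add[symmetric] algebra_simps)
  finally show ?thesis .
qed

text \<open>The exponent \<open>Q - \<beta> * q\<close> is negative, so the radial integral
  converges at infinity. The constant in front is the one whose \<open>q\<close>-th root proves
  optimal.\<close>

lemma tail_integral:
  assumes "\<beta> * q > Q" "s > 0"
  shows "(\<integral>\<^sup>+x. ennreal (N x powr - (\<beta> * q)) * indicator {s..} (N x) \<partial>lborel)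
    = ennreal (sphere_area v N / (\<beta> * q - Q) * s powr (Q - \<beta> * q))"
  using assms sphere_area_pos
  by (simp add: nn_integral_radial_atLeast nn_integral_powr_atLeast flip: ennreal_mult)

text \<open>The radial integral diverges at infinity, which later forces
  \<open>\<beta> * q > Q\<close>.\<close>

lemma tail_integral_infinite:
  assumes "\<beta> * q \<le> Q" "s \<ge> 1"
  shows "(\<integral>\<^sup>+x. ennreal (N x powr - (\<beta> * q)) * indicator {s..} (N x) \<partial>lborel) = \<infinity>"
  using assms sphere_area_pos
  by (simp add: nn_integral_radial_atLeast nn_integral_powr_atLeast_infinite ennreal_mult_top)

section \<open>Necessity of the conditions and the lower bound for the constant\<close>

lemma emeasure_shell_pos:
  assumes "0 < a" "a < b"
  shows "emeasure lborel {x. a \<le> N x \<and> N x \<le> b} > 0"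
proof -
  have op: "open {x. a < N x \<and> N x < b}"
    using open_Collect_conj[OF open_Collect_less[OF continuous_on_const qn_continuous]
        open_Collect_less[OF qn_continuous continuous_on_const]] .
  \<comment> \<open>A nonzero vector, projected to the quasi-sphere and dilated to quasi-norm
    \<open>(a + b) / 2\<close>, shows that the open shell is nonempty.\<close>
  have "(axis undefined 1 :: real^'n) \<noteq> 0" by simp
  then have "N (proj (axis undefined 1)) = 1" by (rule N_proj)
  then have "dil v ((a + b) / 2) (proj (axis undefined 1)) \<in> {x. a < N x \<and> N x < b}"
    using assms by (simp add: qn_dil)
  then have "\<not> negligible {x. a < N x \<and> N x < b}"
    by (intro open_not_negligible[OF op]) (rule ex_in_conv[THEN iffD1, OF exI])
  then have "0 < emeasure lborel {x. a < N x \<and> N x < b}"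
    by (simp add: negligible_iff_emeasure0 zero_less_iff_neq_zero)
  also have "\<dots> \<le> emeasure lborel {x. a \<le> N x \<and> N x \<le> b}"
    by (rule emeasure_mono) auto
  finally show ?thesis .
qed

text \<open>The inequality tested on the indicator of the shell \<open>a \<le> N x \<le> b\<close>; the measure of the shell
  cancels.\<close>
lemma hardy_constant_tail_le:
  assumes C: "hardy_constant N q \<alpha> \<beta> C" and q: "q \<ge> 1" and ab: "0 < a" "a < b"
  shows "ennreal_powr (\<integral>\<^sup>+x. ennreal (N x powr - (\<beta> * q)) * indicator {b..} (N x) \<partial>lborel) (1 / q)
    \<le> ennreal (C * max (a powr \<alpha>) (b powr \<alpha>))" (is "ennreal_powr ?I _ \<le> _")
proof -
  define S where "S = {x. a \<le> N x \<and> N x \<le> b}"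
  have [measurable]: "S \<in> sets borel" unfolding S_def by measurable
  have "emeasure lborel S \<le> emeasure lborel (qball N b)"
    by (rule emeasure_mono) (auto simp: S_def qball_def)
  then obtain m where m: "emeasure lborel S = ennreal m" "m > 0"
    using emeasure_qball_finite[of b] emeasure_shell_pos[OF ab]
    by (cases "emeasure lborel S") (auto simp: S_def top_unique)
  define f :: "real^'n \<Rightarrow> complex" where "f = indicator S"
  have norm_f: "ennreal (norm (f y)) = indicator S y" for y
    by (simp add: f_def indicator_def)
  have "f \<in> borel_measurable lborel" unfolding f_def by measurable
  then have "f \<in> borel_measurable lebesgue" by (rule measurable_completion)
  then have hardy: "hardy_inequality N q \<alpha> \<beta> C f" and "C \<ge> 0"
    using C by (auto simp: hardy_constant_def)
  \<comment> \<open>Bounds \<open>N x powr \<alpha>\<close> on the shell for either sign of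
    \<open>\<alpha>\<close>: the power is monotone, so it is largest at an endpoint.\<close>
  define D where "D = max (a powr \<alpha>) (b powr \<alpha>)"
  have "D \<ge> 0" by (simp add: D_def le_max_iff_disj)
  have "ennreal m * ennreal_powr ?I (1 / q) = ennreal_powr (ennreal (m powr q) * ?I) (1 / q)"
    using m q by (simp add: ennreal_powr_cmult powr_powr)
  also have "ennreal (m powr q) * ?I = (\<integral>\<^sup>+x. ennreal (m powr q) * (ennreal (N x powr - (\<beta> * q)) * indicator {b..} (N x)) \<partial>lborel)"
    by (rule nn_integral_cmult[symmetric]) measurable
  also have "\<dots> \<le> (\<integral>\<^sup>+x. ennreal_powr (\<integral>\<^sup>+y\<in>qball N (N x). ennreal (norm (f y)) \<partial>lborel) q
                * ennreal (N x powr (- \<beta> * q)) \<partial>lborel)"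
  proof (rule nn_integral_mono)
    fix x
    \<comment> \<open>A quasi-ball of radius at least \<open>b\<close> contains the whole shell; the
      contribution of \<open>N x < b\<close> is discarded.\<close>
    have "(\<integral>\<^sup>+y\<in>qball N (N x). ennreal (norm (f y)) \<partial>lborel) = ennreal m" if "N x \<ge> b"
    proof -
      have "(\<integral>\<^sup>+y\<in>qball N (N x). ennreal (norm (f y)) \<partial>lborel) = (\<integral>\<^sup>+y. indicator S y \<partial>lborel)"
        using that by (intro nn_integral_cong) (auto simp: norm_f S_def qball_def split: split_indicator)
      then show ?thesis using m by simp
    qed
    then show "ennreal (m powr q) * (ennreal (N x powr - (\<beta> * q)) * indicator {b..} (N x))
      \<le> ennreal_powr (\<integral>\<^sup>+y\<in>qball N (N x). ennreal (norm (f y)) \<partial>lborel) q * ennreal (N x powr (- \<beta> * q))"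
      using m by (cases "N x \<ge> b") auto
  qed
  then have "ennreal_powr (\<integral>\<^sup>+x. ennreal (m powr q) * (ennreal (N x powr - (\<beta> * q)) * indicator {b..} (N x)) \<partial>lborel) (1 / q)
     \<le> ennreal_powr (\<integral>\<^sup>+x. ennreal_powr (\<integral>\<^sup>+y\<in>qball N (N x). ennreal (norm (f y)) \<partial>lborel) q
                * ennreal (N x powr (- \<beta> * q)) \<partial>lborel) (1 / q)"
    using q by (intro ennreal_powr_mono) auto
  also have "\<dots> \<le> ennreal C * (\<integral>\<^sup>+x. ennreal (norm (f x)) * ennreal (N x powr \<alpha>) \<partial>lborel)"
    using hardy by (simp add: hardy_inequality_def nn_integral_completion)
  also have "\<dots> \<le> ennreal C * (\<integral>\<^sup>+x. ennreal D * indicator S x \<partial>lborel)"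
  proof (intro mult_left_mono nn_integral_mono)
    fix x
    have "N x powr \<alpha> \<le> D" if "x \<in> S"
    proof (cases "\<alpha> \<ge> 0")
      case True
      then have "N x powr \<alpha> \<le> b powr \<alpha>" using that ab by (intro powr_mono2) (auto simp: S_def)
      then show ?thesis by (simp add: D_def)
    next
      case False
      then have "N x powr \<alpha> \<le> a powr \<alpha>" using that ab by (intro powr_mono2') (auto simp: S_def)
      then show ?thesis by (simp add: D_def)
    qed
    then show "ennreal (norm (f x)) * ennreal (N x powr \<alpha>) \<le> ennreal D * indicator S x"
      by (auto simp: norm_f split: split_indicator intro!: ennreal_leI)
  qed simp
  also have "(\<integral>\<^sup>+x. ennreal D * indicator S x \<partial>lborel) = ennreal D * ennreal m"
    using m by (simp add: nn_integral_cmult_indicator)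
  finally have "ennreal m * ennreal_powr ?I (1 / q) \<le> ennreal m * ennreal (C * D)"
    using \<open>C \<ge> 0\<close> \<open>D \<ge> 0\<close> by (simp add: ennreal_mult mult_ac)
  then show ?thesis
    using m by (simp add: ennreal_mult_le_mult_iff D_def)
qed

text \<open>As \<open>a\<close> tends to \<open>b\<close>, the shell estimate becomes
  \<open>K * b powr E \<le> C\<close> for all \<open>b > 0\<close>, where \<open>E\<close> measures
  the failure of the scaling relation. Varying \<open>b\<close> forces \<open>E = 0\<close>, and
  \<open>b = 1\<close> bounds \<open>C\<close> from below.\<close>

lemma hardy_constant_necessary:
  assumes C: "hardy_constant N q \<alpha> \<beta> C" and q: "q \<ge> 1"
  shows "\<beta> * q > Q" "\<alpha> + \<beta> = Q / q" "(sphere_area v N / (\<beta> * q - Q)) powr (1 / q) \<le> C"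
proof -
  show \<beta>: "\<beta> * q > Q"
  proof (rule ccontr)
    assume "\<not> \<beta> * q > Q"
    \<comment> \<open>The upper radius 2 is at least 1, so the tail integral is infinite while the
      right-hand side is finite.\<close>
    then show False
      using hardy_constant_tail_le[OF C q, of 1 2] by (simp add: tail_integral_infinite top_unique)
  qed
  define K where "K = (sphere_area v N / (\<beta> * q - Q)) powr (1 / q)"
  have K: "K > 0" using \<beta> sphere_area_pos by (simp add: K_def)
  define E where "E = (Q - \<beta> * q) / q - \<alpha>"
  have C0: "C \<ge> 0" using C by (simp add: hardy_constant_def)
  have bound: "K * b powr E \<le> C" if b: "b > 0" for b
  proof -
    have "K * b powr ((Q - \<beta> * q) / q) \<le> C * max (a powr \<alpha>) (b powr \<alpha>)" if "a \<in> {0<..<b}" for a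
      using hardy_constant_tail_le[OF C q, of a b] that b \<beta> sphere_area_pos C0
      by (simp add: tail_integral K_def powr_mult powr_powr powr_divide le_max_iff_disj)
    then have "\<forall>\<^sub>F a in at_left b. K * b powr ((Q - \<beta> * q) / q) \<le> C * max (a powr \<alpha>) (b powr \<alpha>)"
      using eventually_at_left_real[OF b] by (rule eventually_mono[rotated])
    moreover have "((\<lambda>a. C * max (a powr \<alpha>) (b powr \<alpha>)) \<longlongrightarrow> C * max (b powr \<alpha>) (b powr \<alpha>)) (at_left b)"
      using b by (intro tendsto_intros) auto
    ultimately have "K * b powr ((Q - \<beta> * q) / q) \<le> C * max (b powr \<alpha>) (b powr \<alpha>)"
      by (intro tendsto_lowerbound) auto
    then show ?thesis
      using b by (simp add: E_def powr_diff pos_divide_le_eq)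
  qed
  have "E = 0"
  proof (rule ccontr)
    assume "E \<noteq> 0"
    \<comment> \<open>With \<open>b = t powr (1 / E)\<close> the bound reads
      \<open>K * t \<le> C\<close>, whereas \<open>K * t = C + K\<close>.\<close>
    define t where "t = C / K + 1"
    have "t > 0" using C0 K by (simp add: t_def add_nonneg_pos)
    then have "K * t \<le> C"
      using bound[of "t powr (1 / E)"] \<open>E \<noteq> 0\<close> by (simp add: powr_powr)
    moreover have "K * t = C + K" using K by (simp add: t_def distrib_left)
    ultimately show False using K by simp
  qed
  then show "\<alpha> + \<beta> = Q / q" using q by (simp add: E_def field_simps)
  show "(sphere_area v N / (\<beta> * q - Q)) powr (1 / q) \<le> C"
    using bound[of 1] by (simp add: K_def)
qed

section \<open>Sufficiency and the upper bound for the constant\<close>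

text \<open>Jensen's inequality for the measure with density \<open>\<bar>f\<bar> N\<^sup>\<alpha>\<close>, followed by Tonelli's theorem, takes the
  place of Minkowski's integral inequality. Any real \<open>m > 0\<close> above the mass of that measure is allowed,
  so that a vanishing mass needs no separate treatment.\<close>
lemma hardy_sufficient_aux:
  fixes g :: "real^'n \<Rightarrow> ennreal"
  assumes [measurable]: "g \<in> borel_measurable borel"
    and q: "q \<ge> 1" and \<beta>: "\<beta> * q > Q" and \<alpha>: "\<alpha> + \<beta> = Q / q"
    and m: "m > 0" "(\<integral>\<^sup>+x. g x * ennreal (N x powr \<alpha>) \<partial>lborel) \<le> ennreal m"
  shows "(\<integral>\<^sup>+x. ennreal_powr (\<integral>\<^sup>+y\<in>qball N (N x). g y \<partial>lborel) q * ennreal (N x powr (- \<beta> * q)) \<partial>lborel)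
     \<le> ennreal (sphere_area v N / (\<beta> * q - Q) * m powr q)"
proof -
  define k where "k = sphere_area v N / (\<beta> * q - Q)"
  have k: "k > 0" using \<beta> sphere_area_pos by (simp add: k_def)
  \<comment> \<open>By \<open>\<alpha> * q + \<beta> * q = Q\<close>, the powers of
    \<open>N y\<close> produced by Jensen's inequality and by the tail integral cancel and leave the
    weight of the right-hand side.\<close>
  have exps: "\<alpha> + (- \<alpha> * q) + (Q - \<beta> * q) = \<alpha>"
    using \<alpha> q by (simp add: field_simps)
  \<comment> \<open>Jensen's inequality is applied to \<open>N y powr - \<alpha>\<close>, which
    undoes the weight; its \<open>q\<close>-th power is the last factor.\<close>
  define G where "G = (\<lambda>y. g y * ennreal (N y powr \<alpha>) * ennreal (N y powr (- \<alpha> * q)))"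
  have [measurable]: "G \<in> borel_measurable borel" unfolding G_def by measurable
  \<comment> \<open>Membership of \<open>y\<close> in the quasi-ball is rewritten as a condition on
    \<open>N x\<close>, ready for the exchange of integrals.\<close>
  have jensen: "ennreal_powr (\<integral>\<^sup>+y\<in>qball N (N x). g y \<partial>lborel) q
      \<le> ennreal (m powr (q - 1)) * (\<integral>\<^sup>+y. G y * indicator {N y..} (N x) \<partial>lborel)" for x
  proof -
    define w where "w = (\<lambda>y. g y * ennreal (N y powr \<alpha>) * indicator (qball N (N x)) y)"
    have w [measurable]: "w \<in> borel_measurable borel" unfolding w_def by measurable
    have "(\<integral>\<^sup>+y. w y \<partial>lborel) \<le> (\<integral>\<^sup>+y. g y * ennreal (N y powr \<alpha>) \<partial>lborel)"
      by (intro nn_integral_mono) (auto simp: w_def split: split_indicator)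
    then have wm: "(\<integral>\<^sup>+y. w y \<partial>lborel) \<le> ennreal m" using m(2) by (rule order_trans)
    have "(\<integral>\<^sup>+y\<in>qball N (N x). g y \<partial>lborel) = (\<integral>\<^sup>+y. w y * ennreal (N y powr - \<alpha>) \<partial>lborel)"
    proof (rule nn_integral_cong_AE)
      show "AE y in lborel. g y * indicator (qball N (N x)) y = w y * ennreal (N y powr - \<alpha>)"
        using AE_lborel_nonzero
      proof eventually_elim
        fix y :: "real^'n" assume "y \<noteq> 0"
        then have "ennreal (N y powr \<alpha>) * ennreal (N y powr - \<alpha>) = 1"
          using N_pos[of y] by (simp add: ennreal_mult[symmetric] powr_add[symmetric])
        then show "g y * indicator (qball N (N x)) y = w y * ennreal (N y powr - \<alpha>)"
          by (auto simp: w_def mult.assoc split: split_indicator)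
      qed
    qed
    also have "ennreal_powr \<dots> q \<le> ennreal (m powr (q - 1)) * (\<integral>\<^sup>+y. w y * ennreal ((N y powr - \<alpha>) powr q) \<partial>lborel)"
      using m wm q by (intro powr_nn_integral_le) auto
    also have "(\<integral>\<^sup>+y. w y * ennreal ((N y powr - \<alpha>) powr q) \<partial>lborel) = (\<integral>\<^sup>+y. G y * indicator {N y..} (N x) \<partial>lborel)"
      by (intro nn_integral_cong) (auto simp: w_def G_def powr_powr qball_def split: split_indicator)
    finally show ?thesis .
  qed
  have "(\<integral>\<^sup>+x. ennreal_powr (\<integral>\<^sup>+y\<in>qball N (N x). g y \<partial>lborel) q * ennreal (N x powr (- \<beta> * q)) \<partial>lborel)
     \<le> (\<integral>\<^sup>+x. (ennreal (m powr (q - 1)) * (\<integral>\<^sup>+y. G y * indicator {N y..} (N x) \<partial>lborel)) * ennreal (N x powr - (\<beta> * q)) \<partial>lborel)"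
    using jensen by (intro nn_integral_mono mult_mono) auto
  also have "\<dots> = (\<integral>\<^sup>+x. \<integral>\<^sup>+y. ennreal (m powr (q - 1)) * G y * (ennreal (N x powr - (\<beta> * q)) * indicator {N y..} (N x)) \<partial>lborel \<partial>lborel)"
  proof (rule nn_integral_cong)
    fix x
    have [measurable]: "(\<lambda>y. G y * indicator {N y..} (N x)) \<in> borel_measurable lborel"
      unfolding atLeast_def by measurable
    have "(\<integral>\<^sup>+y. ennreal (m powr (q - 1)) * G y * (ennreal (N x powr - (\<beta> * q)) * indicator {N y..} (N x)) \<partial>lborel)
      = (\<integral>\<^sup>+y. (ennreal (m powr (q - 1)) * ennreal (N x powr - (\<beta> * q))) * (G y * indicator {N y..} (N x)) \<partial>lborel)"
      by (simp add: mult_ac)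
    also have "\<dots> = (ennreal (m powr (q - 1)) * ennreal (N x powr - (\<beta> * q))) * (\<integral>\<^sup>+y. G y * indicator {N y..} (N x) \<partial>lborel)"
      by (rule nn_integral_cmult) measurable
    finally show "(ennreal (m powr (q - 1)) * (\<integral>\<^sup>+y. G y * indicator {N y..} (N x) \<partial>lborel)) * ennreal (N x powr - (\<beta> * q))
      = (\<integral>\<^sup>+y. ennreal (m powr (q - 1)) * G y * (ennreal (N x powr - (\<beta> * q)) * indicator {N y..} (N x)) \<partial>lborel)"
      by (simp add: mult_ac)
  qed
  \<comment> \<open>After Tonelli's theorem the integral over \<open>x\<close> is the tail integral
    from \<open>s = N y\<close>.\<close>
  also have "\<dots> = (\<integral>\<^sup>+y. \<integral>\<^sup>+x. ennreal (m powr (q - 1)) * G y * (ennreal (N x powr - (\<beta> * q)) * indicator {N y..} (N x)) \<partial>lborel \<partial>lborel)"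
    by (intro lborel_pair.Fubini') (simp add: atLeast_def case_prod_unfold)
  also have "\<dots> = (\<integral>\<^sup>+y. ennreal (m powr (q - 1)) * G y * (\<integral>\<^sup>+x. ennreal (N x powr - (\<beta> * q)) * indicator {N y..} (N x) \<partial>lborel) \<partial>lborel)"
    by (intro nn_integral_cong nn_integral_cmult) measurable
  also have "\<dots> = (\<integral>\<^sup>+y. ennreal (m powr (q - 1) * k) * (g y * ennreal (N y powr \<alpha>)) \<partial>lborel)"
  proof (rule nn_integral_cong_AE)
    show "AE y in lborel. ennreal (m powr (q - 1)) * G y * (\<integral>\<^sup>+x. ennreal (N x powr - (\<beta> * q)) * indicator {N y..} (N x) \<partial>lborel)
        = ennreal (m powr (q - 1) * k) * (g y * ennreal (N y powr \<alpha>))"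
      using AE_lborel_nonzero
    proof eventually_elim
      fix y :: "real^'n" assume "y \<noteq> 0"
      then have Ny: "N y > 0" by (rule N_pos)
      have "ennreal (N y powr \<alpha>) * ennreal (N y powr (- \<alpha> * q)) * ennreal (N y powr (Q - \<beta> * q)) = ennreal (N y powr \<alpha>)"
        using exps by (simp flip: ennreal_mult powr_add)
      moreover have "(\<integral>\<^sup>+x. ennreal (N x powr - (\<beta> * q)) * indicator {N y..} (N x) \<partial>lborel) = ennreal k * ennreal (N y powr (Q - \<beta> * q))"
        unfolding tail_integral[OF \<beta> Ny] k_def[symmetric] using k by (intro ennreal_mult) auto
      ultimately have "G y * (\<integral>\<^sup>+x. ennreal (N x powr - (\<beta> * q)) * indicator {N y..} (N x) \<partial>lborel)
         = ennreal k * (g y * ennreal (N y powr \<alpha>))"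
        unfolding G_def by (metis mult.assoc mult.left_commute)
      then show "ennreal (m powr (q - 1)) * G y * (\<integral>\<^sup>+x. ennreal (N x powr - (\<beta> * q)) * indicator {N y..} (N x) \<partial>lborel)
        = ennreal (m powr (q - 1) * k) * (g y * ennreal (N y powr \<alpha>))"
        using k by (simp add: mult.assoc ennreal_mult)
    qed
  qed
  also have "\<dots> = ennreal (m powr (q - 1) * k) * (\<integral>\<^sup>+y. g y * ennreal (N y powr \<alpha>) \<partial>lborel)"
    by (rule nn_integral_cmult) measurable
  also have "\<dots> \<le> ennreal (m powr (q - 1) * k) * ennreal m"
    by (intro mult_left_mono m) simp
  also have "\<dots> = ennreal (m powr (q - 1) * k * m)"
    using m k by (simp add: ennreal_mult[symmetric])
  also have "m powr (q - 1) * k * m = k * m powr q"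
    using m by (simp add: powr_diff)
  finally show ?thesis by (simp add: k_def)
qed

text \<open>The \<open>q\<close>-th root of the preceding bound is \<open>K * m\<close>, for every
  positive real \<open>m\<close> not below the weighted mass of \<open>f\<close>; letting
  \<open>m\<close> approach that mass gives the inequality.\<close>

lemma hardy_constant_sufficient:
  assumes q: "q \<ge> 1" and \<beta>: "\<beta> * q > Q" and \<alpha>: "\<alpha> + \<beta> = Q / q"
  shows "hardy_constant N q \<alpha> \<beta> ((sphere_area v N / (\<beta> * q - Q)) powr (1 / q))"
  unfolding hardy_constant_def
proof (intro conjI ballI)
  define K where "K = (sphere_area v N / (\<beta> * q - Q)) powr (1 / q)"
  have K: "K > 0" using \<beta> sphere_area_pos by (simp add: K_def)
  show "(sphere_area v N / (\<beta> * q - Q)) powr (1 / q) \<ge> 0" by simp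
  fix f :: "real^'n \<Rightarrow> complex" assume "f \<in> borel_measurable lebesgue"
  then have "(\<lambda>x. ennreal (norm (f x))) \<in> borel_measurable (completion lborel)" by measurable
  \<comment> \<open>A Borel representative of the norm of \<open>f\<close> brings all integrals down
    to \<open>lborel\<close>, where Tonelli's theorem was applied.\<close>
  then obtain g where g: "g \<in> borel_measurable lborel" and fg: "AE x in lborel. ennreal (norm (f x)) = g x"
    by (blast dest: completion_ex_borel_measurable)
  have [measurable]: "g \<in> borel_measurable borel" using g by simp
  have inner: "(\<integral>\<^sup>+y\<in>qball N (N x). ennreal (norm (f y)) \<partial>lebesgue) = (\<integral>\<^sup>+y\<in>qball N (N x). g y \<partial>lborel)" for x
    unfolding nn_integral_completion using fg by (intro nn_integral_cong_AE) auto
  have rhs: "(\<integral>\<^sup>+x. ennreal (norm (f x)) * ennreal (N x powr \<alpha>) \<partial>lebesgue) = (\<integral>\<^sup>+x. g x * ennreal (N x powr \<alpha>) \<partial>lborel)"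
    unfolding nn_integral_completion using fg by (intro nn_integral_cong_AE) auto
  define M where "M = (\<integral>\<^sup>+x. g x * ennreal (N x powr \<alpha>) \<partial>lborel)"
  have "ennreal_powr (\<integral>\<^sup>+x. ennreal_powr (\<integral>\<^sup>+y\<in>qball N (N x). g y \<partial>lborel) q * ennreal (N x powr (- \<beta> * q)) \<partial>lborel) (1 / q)
      \<le> ennreal K * M" (is "?L \<le> _")
  proof (rule ennreal_le_epsilon)
    fix e :: real assume fin: "ennreal K * M < top_class.top" and e: "e > 0"
    then obtain r where r: "M = ennreal r" "r \<ge> 0"
      using K by (cases M) (auto simp: ennreal_mult_top)
    \<comment> \<open>Positive even when \<open>r = 0\<close>, and \<open>K * m\<close> exceeds
      \<open>K * r\<close> by exactly \<open>e\<close>.\<close>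
    define m where "m = r + e / K"
    have m: "m > 0" using r e K by (simp add: m_def add_nonneg_pos)
    have "M \<le> ennreal m" using r e K by (simp add: m_def ennreal_leI)
    then have "?L \<le> ennreal_powr (ennreal (sphere_area v N / (\<beta> * q - Q) * m powr q)) (1 / q)"
      using hardy_sufficient_aux[OF _ q \<beta> \<alpha> m, of g] q by (intro ennreal_powr_mono) (auto simp: M_def)
    also have "\<dots> = ennreal (K * m)"
      using m q \<beta> sphere_area_pos by (simp add: K_def powr_mult powr_divide powr_powr)
    also have "K * m = K * r + e" using K by (simp add: m_def field_simps)
    also have "ennreal \<dots> = ennreal K * M + ennreal e"
      using r K e by (simp add: ennreal_mult)
    finally show "?L \<le> ennreal K * M + ennreal e" .
  qed
  then show "hardy_inequality N q \<alpha> \<beta> ((sphere_area v N / (\<beta> * q - Q)) powr (1 / q)) f"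
    unfolding hardy_inequality_def inner rhs M_def K_def by (simp add: nn_integral_completion)
qed

end

theorem corollary3p3:
  fixes G :: "(real^'n::finite) monoid"
    and v :: "'n \<Rightarrow> real"
    and N :: "real^'n \<Rightarrow> real"
    and q \<alpha> \<beta> :: real
  assumes "homogeneous_quasi_norm G v N"
    and "q \<ge> 1"
  shows "((\<exists>C. hardy_constant N q \<alpha> \<beta> C) \<longleftrightarrow>
            \<beta> * q > hom_dim v \<and> \<alpha> < 0 \<and> \<alpha> + \<beta> = hom_dim v / q) \<and>
         (\<beta> * q > hom_dim v \<and> \<alpha> < 0 \<and> \<alpha> + \<beta> = hom_dim v / q \<longrightarrow>
            (let C\<^sub>0 = sphere_area v N powr (1 / q) * (1 / \<bar>\<beta> * q - hom_dim v\<bar> powr (1 / q))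
             in hardy_constant N q \<alpha> \<beta> C\<^sub>0 \<and> (\<forall>C. hardy_constant N q \<alpha> \<beta> C \<longrightarrow> C\<^sub>0 \<le> C)))"
proof -
  interpret homogeneous_quasi_norm G v N by fact
  note q = \<open>q \<ge> 1\<close>
  have C\<^sub>0: "sphere_area v N powr (1 / q) * (1 / \<bar>\<beta> * q - Q\<bar> powr (1 / q)) = (sphere_area v N / (\<beta> * q - Q)) powr (1 / q)"
    if "\<beta> * q > Q"
    using that sphere_area_pos by (simp add: powr_divide)
  \<comment> \<open>Since \<open>\<beta> * q > Q\<close> means \<open>Q / q < \<beta>\<close>, the
    scaling relation determines the sign of \<open>\<alpha>\<close>.\<close>
  have "\<alpha> < 0" if "\<beta> * q > Q" "\<alpha> + \<beta> = Q / q"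
  proof -
    have "Q / q < \<beta>" using that q by (simp add: divide_less_eq)
    then show ?thesis using that by simp
  qed
  then show ?thesis
    using hardy_constant_necessary[OF _ q] hardy_constant_sufficient[OF q] C\<^sub>0
    unfolding Let_def by metis
qed

end
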